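(* IKC(no-mod) satisfies the Richness, Inter-edge Consistency and Fixed Point axioms, but violates the Standard Consistency, Refinement Consistency, Connectivity and Pair-of-Cliques axioms.
   Context: A network is a finite simple undirected unweighted graph $N=(V,E)$; a clustering is a partition of $V$ into nonempty clusters; $N[S]$ is the induced subgraph on $S\subseteq V$. For an integer $k\ge0$, the $k$-core of a graph $H$ is the subgraph obtained by repeatedly deleting vertices of degree less than $k$ (in the current subgraph) until none remain, i.e. the maximal induced subgraph of minimum degree at least $k$ (possibly empty). IKC(no-mod): on input $N=(V,E)$, set $R=V$; while $R\neq\emptyset$: let $k$ be the largest integer such that the $k$-core of $N[R]$ is nonempty; output the vertex set of each connected component of this $k$-core as a cluster, and remove these vertices from $R$. It is deterministic; write $M(N)$ for its output. Axioms for a deterministic method $M$: Richness: for every finite $V$ and every partition $\Gamma$ of $V$ (including $\{V\}$) there is $E$ with $M((V,E))=\Gamma$. Standard Consistency: whenever $E'$ is obtained from $E$ by deleting some edges between different clusters of $M(N)$ and/or adding some edges with both endpoints in a common cluster of $M(N)$, $M((V,E'))=M(N)$. Refinement Consistency: for such $E'$, every cluster of $M((V,E'))$ is contained in a cluster of $M(N)$. Inter-edge Consistency: whenever $E'$ is obtained from $E$ by only deleting edges between different clusters of $M(N)$, $M((V,E'))=M(N)$. Connectivity: there is a non-negative non-decreasing $f:\mathbb{R}^+\to\mathbb{R}^+$ with $f(x)\to\infty$ such that for every $N$ and every $c\in M(N)$ with $|c|\ge 2$, the minimum number of edges of $N[c]$ whose removal disconnects $N[c]$ is strictly greater than $f(|c|)$.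 Pair-of-Cliques: a pair-of-cliques component is a connected component with vertex set $A\cup B$, $A\cap B=\emptyset$, $|A|=|B|=n$, $A,B$ cliques, exactly one edge between $A$ and $B$; size $2n$. The axiom holds if there is $n_0$ such that for every $N$ and every pair-of-cliques component of size $\ge n_0$, $A$ and $B$ are clusters of $M(N)$. Fixed Point: for every $N$ and every nonempty $\mathcal{D}\subseteq M(N)$, $M(N[\bigcup\mathcal{D}])=\mathcal{D}$. *)

theory Defs
  imports Complex_Main "HOL-Library.Disjoint_Sets" "HOL-Library.While_Combinator"
begin

type_synonym 'a graph = "'a set \<times> 'a set set"

abbreviation verts :: "'a graph \<Rightarrow> 'a set" where "verts \<equiv> fst"
abbreviation edges :: "'a graph \<Rightarrow> 'a set set" where "edges \<equiv> snd"

definition network :: "'a graph \<Rightarrow> bool" where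
  "network N \<longleftrightarrow> finite (verts N) \<and> (\<forall>e\<in>edges N. e \<subseteq> verts N \<and> card e = 2)"

definition induced :: "'a graph \<Rightarrow> 'a set \<Rightarrow> 'a graph" where
  "induced N S = (S, {e \<in> edges N. e \<subseteq> S})"

definition degree :: "'a graph \<Rightarrow> 'a \<Rightarrow> nat" where
  "degree H v = card {e \<in> edges H. v \<in> e}"

definition reachable :: "'a graph \<Rightarrow> ('a \<times> 'a) set" where
  "reachable H = {(u, v). {u, v} \<in> edges H}\<^sup>*"

definition connected_graph :: "'a graph \<Rightarrow> bool" where
  "connected_graph H \<longleftrightarrow> (\<forall>u\<in>verts H. \<forall>v\<in>verts H. (u, v) \<in> reachable H)"

definition conn_components :: "'a graph \<Rightarrow> 'a set set" where
  "conn_components H = {{v \<in> verts H. (u, v) \<in> reachable H} | u. u \<in> verts H}"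

subsection \<open>Cores\<close>

definition min_degree_ge :: "nat \<Rightarrow> 'a graph \<Rightarrow> bool" where
  "min_degree_ge k H \<longleftrightarrow> (\<forall>v\<in>verts H. k \<le> degree H v)"

text \<open>The vertex sets inducing a subgraph of minimum degree at least \<open>k\<close> are closed under
  union, so their union is the largest of them (\<open>k_core_greatest\<close>); it is what is left when
  vertices of degree less than \<open>k\<close> are deleted one at a time, in any order
  (\<open>k_core_by_deletion\<close>).\<close>

definition k_core :: "nat \<Rightarrow> 'a graph \<Rightarrow> 'a graph" where
  "k_core k H = induced H (\<Union>{S. S \<subseteq> verts H \<and> min_degree_ge k (induced H S)})"

definition deletion_step :: "nat \<Rightarrow> 'a graph \<Rightarrow> ('a set \<times> 'a set) set" where
  "deletion_step k H = {(S, S - {v}) | S v. v \<in> S \<and> degree (induced H S) v < k}"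

lemma network_finite_edges: "network N \<Longrightarrow> finite (edges N)"
  unfolding network_def by (rule finite_subset[of _ "Pow (verts N)"]) auto

lemma degree_induced_mono:
  assumes "finite (edges H)" "S \<subseteq> T"
  shows "degree (induced H S) v \<le> degree (induced H T) v"
  unfolding degree_def induced_def using assms by (auto intro!: card_mono)

lemma k_core_greatest:
  assumes "finite (edges H)"
  shows "verts (k_core k H) \<subseteq> verts H" "min_degree_ge k (k_core k H)"
    "S \<subseteq> verts H \<Longrightarrow> min_degree_ge k (induced H S) \<Longrightarrow> S \<subseteq> verts (k_core k H)"
proof -
  let ?U = "\<Union>{S. S \<subseteq> verts H \<and> min_degree_ge k (induced H S)}"
  show "verts (k_core k H) \<subseteq> verts H"
    unfolding k_core_def by (auto simp: induced_def)
  show "S \<subseteq> verts H \<Longrightarrow> min_degree_ge k (induced H S) \<Longrightarrow> S \<subseteq> verts (k_core k H)"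
    unfolding k_core_def by (auto simp: induced_def)
  have "k \<le> degree (induced H ?U) v" if "v \<in> ?U" for v
  proof -
    from that obtain S where S: "v \<in> S" "S \<subseteq> verts H" "min_degree_ge k (induced H S)" by blast
    then have "k \<le> degree (induced H S) v"
      unfolding min_degree_ge_def by (simp add: induced_def)
    also have "\<dots> \<le> degree (induced H ?U) v"
      using S by (intro degree_induced_mono assms) blast
    finally show ?thesis .
  qed
  then show "min_degree_ge k (k_core k H)"
    unfolding k_core_def min_degree_ge_def by (simp add: induced_def)
qed

lemma k_core_by_deletion:
  assumes "finite (edges H)"
    and steps: "(verts H, T) \<in> (deletion_step k H)\<^sup>*"
    and stop: "T \<notin> Domain (deletion_step k H)"
  shows "k_core k H = induced H T"
proof -
  let ?U = "verts (k_core k H)"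
  have U: "k_core k H = induced H ?U"
    by (simp add: k_core_def induced_def)
  from steps have T: "?U \<subseteq> T \<and> T \<subseteq> verts H"
  proof induction
    case base
    show ?case using k_core_greatest(1)[OF assms(1)] by simp
  next
    case (step S T)
    then obtain v where v: "T = S - {v}" "degree (induced H S) v < k"
      unfolding deletion_step_def by blast
    have "v \<notin> ?U"
    proof
      assume "v \<in> ?U"
      then have "k \<le> degree (k_core k H) v"
        using k_core_greatest(2)[OF assms(1)] unfolding min_degree_ge_def by blast
      also have "\<dots> \<le> degree (induced H S) v"
        using step.IH by (subst U) (intro degree_induced_mono assms(1), blast)
      finally show False using v by simp
    qed
    then show ?case using v step.IH by blast
  qed
  have "min_degree_ge k (induced H T)"
    using stop unfolding min_degree_ge_def deletion_step_def Domain_iff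
    by (auto simp: induced_def not_less[symmetric])
  then have "T \<subseteq> ?U" using k_core_greatest(3)[OF assms(1)] T by blast
  then show ?thesis using T U by auto
qed

subsection \<open>IKC without modularity\<close>

definition max_core_number :: "'a graph \<Rightarrow> nat" where
  "max_core_number H = (GREATEST k. verts (k_core k H) \<noteq> {})"

definition max_core :: "'a graph \<Rightarrow> 'a graph" where
  "max_core H = k_core (max_core_number H) H"

definition ikc_nomod :: "'a graph \<Rightarrow> 'a set set" where
  "ikc_nomod N = snd (while (\<lambda>(R, \<Gamma>). R \<noteq> {})
     (\<lambda>(R, \<Gamma>). (R - verts (max_core (induced N R)),
                  \<Gamma> \<union> conn_components (max_core (induced N R))))
     (verts N, {}))"

lemma max_core_nonempty:
  assumes "finite (edges H)" "verts H \<noteq> {}"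
  shows "verts (max_core H) \<noteq> {}"
    "k \<le> max_core_number H \<longleftrightarrow> verts (k_core k H) \<noteq> {}"
proof -
  let ?P = "\<lambda>k. verts (k_core k H) \<noteq> {}"
  have 0: "?P 0"
    using k_core_greatest(3)[OF assms(1), of "verts H" 0] assms(2)
    by (auto simp: min_degree_ge_def)
  have bd: "k \<le> card (edges H)" if P: "?P k" for k
  proof -
    from P obtain v where "v \<in> verts (k_core k H)" by blast
    then have "k \<le> degree (k_core k H) v"
      using k_core_greatest(2)[OF assms(1)] unfolding min_degree_ge_def by blast
    also have "\<dots> \<le> card (edges H)"
      unfolding degree_def k_core_def induced_def using assms(1) by (auto intro!: card_mono)
    finally show ?thesis .
  qed
  have top: "?P (max_core_number H)"
    unfolding max_core_number_def using GreatestI_nat[of ?P 0] 0 bd by blast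
  then show "verts (max_core H) \<noteq> {}" unfolding max_core_def .
  show "k \<le> max_core_number H \<longleftrightarrow> ?P k"
  proof
    assume k: "k \<le> max_core_number H"
    have "verts (k_core (max_core_number H) H) \<subseteq> verts (k_core k H)"
      using k unfolding k_core_def min_degree_ge_def induced_def
      by (auto intro: order_trans)
    then show "?P k" using top by blast
  next
    assume "?P k"
    then show "k \<le> max_core_number H"
      unfolding max_core_number_def using Greatest_le_nat[of ?P k] bd by blast
  qed
qed

lemma conn_components_partition: "partition_on (verts H) (conn_components H)"
proof -
  have "sym (reachable H)"
    unfolding reachable_def by (intro sym_rtrancl) (auto simp: sym_def insert_commute)
  then have sy: "(v, u) \<in> reachable H" if "(u, v) \<in> reachable H" for u v
    using that by (meson symE)
  have tr: "(u, w) \<in> reachable H" if "(u, v) \<in> reachable H" "(v, w) \<in> reachable H" for u v w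
    using that unfolding reachable_def by (rule rtrancl_trans)
  have re: "(u, u) \<in> reachable H" for u
    unfolding reachable_def by simp
  show ?thesis
  proof (rule partition_onI)
    show "\<Union>(conn_components H) = verts H"
      unfolding conn_components_def using re by blast
    show "{} \<notin> conn_components H"
      using re unfolding conn_components_def by blast
    show "disjnt p q" if pq: "p \<in> conn_components H" "q \<in> conn_components H" "p \<noteq> q" for p q
    proof (rule ccontr)
      assume "\<not> disjnt p q"
      then obtain w where w: "w \<in> p" "w \<in> q" by (auto simp: disjnt_def)
      obtain u v where "p = {x \<in> verts H. (u, x) \<in> reachable H}"
        "q = {x \<in> verts H. (v, x) \<in> reachable H}"
        using pq unfolding conn_components_def by blast
      then have "p = q" using w sy tr by blast
      then show False using pq by blast
    qed
  qed
qed

lemma ikc_nomod_partition: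
  assumes "network N"
  shows "partition_on (verts N) (ikc_nomod N)"
proof -
  let ?b = "\<lambda>(R, \<Gamma> :: 'a set set). R \<noteq> ({} :: 'a set)"
  let ?c = "\<lambda>(R, \<Gamma>). (R - verts (max_core (induced N R)),
                  \<Gamma> \<union> conn_components (max_core (induced N R)))"
  let ?I = "\<lambda>(R, \<Gamma>). R \<subseteq> verts N \<and> partition_on (verts N - R) \<Gamma>"
  have fin: "finite (verts N)" using assms by (simp add: network_def)
  have fe: "finite (edges (induced N R))" for R
    using network_finite_edges[OF assms] by (simp add: induced_def)
  have sub: "verts (max_core (induced N R)) \<subseteq> R" for R
    using k_core_greatest(1)[OF fe, of _ R] unfolding max_core_def by (simp add: induced_def)
  have ne: "verts (max_core (induced N R)) \<noteq> {}" if "R \<noteq> {}" for R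
    using max_core_nonempty(1)[OF fe] that by (simp add: induced_def)
  have "?I (while ?b ?c (verts N, {})) \<and> \<not> ?b (while ?b ?c (verts N, {}))"
  proof (rule while_rule[where P = ?I and r = "measure (\<lambda>(R, \<Gamma>). card (R \<inter> verts N))"], goal_cases)
    case 1
    show ?case by (simp add: partition_on_def)
  next
    case (2 s)
    obtain R \<Gamma> where s: "s = (R, \<Gamma>)" by force
    let ?K = "verts (max_core (induced N R))"
    have "verts N - (R - ?K) = (verts N - R) \<union> ?K"
      using 2 sub[of R] unfolding s by auto
    moreover have "partition_on ((verts N - R) \<union> ?K)
        (\<Gamma> \<union> conn_components (max_core (induced N R)))"
    proof -
      have p: "partition_on (verts N - R) \<Gamma>"
        using 2 unfolding s by simp
      have q: "partition_on ?K (conn_components (max_core (induced N R)))"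
        by (rule conn_components_partition)
      have "\<Union>\<Gamma> \<inter> \<Union>(conn_components (max_core (induced N R))) = {}"
        using p q sub[of R] unfolding partition_on_def by blast
      then have "disjoint (\<Gamma> \<union> conn_components (max_core (induced N R)))"
        using p q unfolding partition_on_def by (intro disjoint_union) blast+
      then show ?thesis using p q unfolding partition_on_def by simp
    qed
    ultimately show ?case using 2 unfolding s by auto
  next
    case (3 s)
    then show ?case by (cases s) auto
  next
    case 4
    show ?case by simp
  next
    case (5 s)
    obtain R \<Gamma> where s: "s = (R, \<Gamma>)" by force
    have "(R - verts (max_core (induced N R))) \<inter> verts N \<subset> R \<inter> verts N"
      using 5 sub[of R] ne[of R] unfolding s by auto
    then show ?case using fin unfolding s by (auto intro: psubset_card_mono)
  qed
  then show ?thesis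
    unfolding ikc_nomod_def by (auto split: prod.splits)
qed

subsection \<open>Axioms\<close>

type_synonym 'a clustering_method = "'a graph \<Rightarrow> 'a set set"

definition richness :: "'a clustering_method \<Rightarrow> bool" where
  "richness M \<longleftrightarrow>
     (\<forall>V \<Gamma>. finite V \<longrightarrow> partition_on V \<Gamma> \<longrightarrow> (\<exists>E. network (V, E) \<and> M (V, E) = \<Gamma>))"

definition inter_pairs :: "'a set set \<Rightarrow> 'a set set" where
  "inter_pairs \<Gamma> = {{u, v} | u v. \<exists>c\<in>\<Gamma>. \<exists>d\<in>\<Gamma>. c \<noteq> d \<and> u \<in> c \<and> v \<in> d}"

definition intra_pairs :: "'a set set \<Rightarrow> 'a set set" where
  "intra_pairs \<Gamma> = {{u, v} | u v. u \<noteq> v \<and> (\<exists>c\<in>\<Gamma>. u \<in> c \<and> v \<in> c)}"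

definition consistent_change :: "'a set set \<Rightarrow> 'a set set \<Rightarrow> 'a set set \<Rightarrow> bool" where
  "consistent_change \<Gamma> E E' \<longleftrightarrow>
     (\<exists>D A. D \<subseteq> E \<inter> inter_pairs \<Gamma> \<and> A \<subseteq> intra_pairs \<Gamma> \<and> E' = (E - D) \<union> A)"

definition inter_edge_change :: "'a set set \<Rightarrow> 'a set set \<Rightarrow> 'a set set \<Rightarrow> bool" where
  "inter_edge_change \<Gamma> E E' \<longleftrightarrow> (\<exists>D. D \<subseteq> E \<inter> inter_pairs \<Gamma> \<and> E' = E - D)"

definition standard_consistency :: "'a clustering_method \<Rightarrow> bool" where
  "standard_consistency M \<longleftrightarrow>
     (\<forall>V E E'. network (V, E) \<longrightarrow> network (V, E') \<longrightarrow> consistent_change (M (V, E)) E E' \<longrightarrow>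
        M (V, E') = M (V, E))"

definition refinement_consistency :: "'a clustering_method \<Rightarrow> bool" where
  "refinement_consistency M \<longleftrightarrow>
     (\<forall>V E E'. network (V, E) \<longrightarrow> network (V, E') \<longrightarrow> consistent_change (M (V, E)) E E' \<longrightarrow>
        (\<forall>c'\<in>M (V, E'). \<exists>c\<in>M (V, E). c' \<subseteq> c))"

definition inter_edge_consistency :: "'a clustering_method \<Rightarrow> bool" where
  "inter_edge_consistency M \<longleftrightarrow>
     (\<forall>V E E'. network (V, E) \<longrightarrow> network (V, E') \<longrightarrow> inter_edge_change (M (V, E)) E E' \<longrightarrow>
        M (V, E') = M (V, E))"

text \<open>Meaningful for finite graphs with at least two vertices: deleting all edges then
  disconnects the graph, so the minimum is over a nonempty finite set.  It is 0 if the graph is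
  already disconnected.\<close>

definition min_edge_cut :: "'a graph \<Rightarrow> nat" where
  "min_edge_cut H =
     Min (card ` {F. F \<subseteq> edges H \<and> \<not> connected_graph (verts H, edges H - F)})"

definition connectivity_axiom :: "'a clustering_method \<Rightarrow> bool" where
  "connectivity_axiom M \<longleftrightarrow>
     (\<exists>f :: real \<Rightarrow> real.
        (\<forall>x>0. 0 \<le> f x) \<and> mono_on {0<..} f \<and> filterlim f at_top at_top \<and>
        (\<forall>N. network N \<longrightarrow> (\<forall>c\<in>M N. 2 \<le> card c \<longrightarrow>
           f (real (card c)) < real (min_edge_cut (induced N c)))))"

definition clique :: "'a graph \<Rightarrow> 'a set \<Rightarrow> bool" where
  "clique N A \<longleftrightarrow> A \<subseteq> verts N \<and> (\<forall>u\<in>A. \<forall>v\<in>A. u \<noteq> v \<longrightarrow> {u, v} \<in> edges N)"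

definition pair_of_cliques :: "'a graph \<Rightarrow> 'a set \<Rightarrow> 'a set \<Rightarrow> nat \<Rightarrow> bool" where
  "pair_of_cliques N A B n \<longleftrightarrow>
     A \<union> B \<in> conn_components N \<and> A \<inter> B = {} \<and> card A = n \<and> card B = n \<and>
     clique N A \<and> clique N B \<and> (\<exists>!e. e \<in> edges N \<and> (\<exists>a\<in>A. \<exists>b\<in>B. e = {a, b}))"

definition pair_of_cliques_axiom :: "'a clustering_method \<Rightarrow> bool" where
  "pair_of_cliques_axiom M \<longleftrightarrow>
     (\<exists>n0. \<forall>N A B n. network N \<longrightarrow> pair_of_cliques N A B n \<longrightarrow> n0 \<le> 2 * n \<longrightarrow>
        A \<in> M N \<and> B \<in> M N)"

definition fixed_point :: "'a clustering_method \<Rightarrow> bool" where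
  "fixed_point M \<longleftrightarrow>
     (\<forall>N \<D>. network N \<longrightarrow> \<D> \<subseteq> M N \<longrightarrow> \<D> \<noteq> {} \<longrightarrow> M (induced N (\<Union>\<D>)) = \<D>)"

end

theory Submission
  imports Defs
begin

text \<open>IKC removes cores of strictly decreasing order.  Give each vertex the order of the core it is
  removed with.  The output is then the set of components of the graph formed by the edges inside
  a level, and the level function is certified by two local conditions (\<open>core_levels\<close>):
  every vertex has at least as many neighbours in its own level as the level says, and no set
  of vertices of level at most \<open>k\<close> spans minimum degree \<open>k\<close> unless all of them have level
  \<open>k\<close>.  Deleting edges between clusters and passing to a union of clusters preserve the
  certificate, which gives Inter-edge Consistency and Fixed Point; disjoint cliques give Richness.

  Two \<open>n\<close>-cliques joined by an edge form a single \<open>(n-1)\<close>-core, hence one cluster with an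
  edge cut of size 1.  This refutes Pair-of-Cliques and Connectivity.  A triangle joined by an edge
  to the centre of a 3-vertex star is split into the triangle and the star, but completing the star
  to a triangle merges the two, which refutes both consistency axioms.\<close>

section \<open>Neighbourhoods and components\<close>

text \<open>Degrees are counted by neighbours rather than by incident edges: the degree of
  \<open>v\<close> inside an induced subgraph on \<open>S\<close> is then simply
  \<open>card (S \<inter> neighbours N v)\<close>.\<close>

definition neighbours :: "'a graph \<Rightarrow> 'a \<Rightarrow> 'a set" where
  "neighbours N v = {u. {u, v} \<in> edges N}"

lemma neighbours_subset: "network N \<Longrightarrow> neighbours N v \<subseteq> verts N - {v}"
  unfolding network_def neighbours_def by (fastforce simp: card_2_iff)

lemma finite_neighbours: "network N \<Longrightarrow> finite (neighbours N v)"
  using neighbours_subset[of N v] unfolding network_def by (meson finite_Diff finite_subset)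

lemma network_induced: "network N \<Longrightarrow> S \<subseteq> verts N \<Longrightarrow> network (induced N S)"
  unfolding network_def induced_def by (auto intro: finite_subset)

lemma verts_induced [simp]: "verts (induced N S) = S"
  by (simp add: induced_def)

lemma induced_induced: "T \<subseteq> S \<Longrightarrow> induced (induced N S) T = induced N T"
  by (auto simp: induced_def)

lemma induced_verts: "network N \<Longrightarrow> induced N (verts N) = N"
  by (cases N) (auto simp: induced_def network_def)

lemma neighbours_induced: "v \<in> S \<Longrightarrow> neighbours (induced N S) v = S \<inter> neighbours N v"
  by (auto simp: neighbours_def induced_def)

lemma degree_eq_card_neighbours:
  assumes "network N"
  shows "degree N v = card (neighbours N v)"
proof -
  have "{e \<in> edges N. v \<in> e} = (\<lambda>u. {u, v}) ` neighbours N v"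
    using assms unfolding network_def neighbours_def
    by (fastforce simp: card_2_iff insert_commute)
  moreover have "inj_on (\<lambda>u. {u, v}) (neighbours N v)"
    by (auto simp: inj_on_def doubleton_eq_iff)
  ultimately show ?thesis by (simp add: degree_def card_image)
qed

lemma min_degree_ge_induced:
  assumes "network N" "S \<subseteq> verts N"
  shows "min_degree_ge k (induced N S) \<longleftrightarrow> (\<forall>v\<in>S. k \<le> card (S \<inter> neighbours N v))"
  using degree_eq_card_neighbours[OF network_induced[OF assms]]
  by (simp add: min_degree_ge_def neighbours_induced)

lemma k_core_eq_induced: "k_core k (induced N R) = induced N (verts (k_core k (induced N R)))"
  unfolding k_core_def by (subst induced_induced) auto

text \<open>Expresses the greatest-set property of cores through the neighbourhoods of the fixed
  graph \<open>N\<close>, so that later arguments compare cores of different remainders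
  \<open>R\<close> without nested induced subgraphs.\<close>

lemma k_core_induced:
  assumes "network N" "R \<subseteq> verts N"
  shows "verts (k_core k (induced N R)) \<subseteq> R"
    and "v \<in> verts (k_core k (induced N R)) \<Longrightarrow>
      k \<le> card (verts (k_core k (induced N R)) \<inter> neighbours N v)"
    and "S \<subseteq> R \<Longrightarrow> (\<And>v. v \<in> S \<Longrightarrow> k \<le> card (S \<inter> neighbours N v)) \<Longrightarrow>
      S \<subseteq> verts (k_core k (induced N R))"
proof -
  let ?K = "verts (k_core k (induced N R))"
  note fin = network_finite_edges[OF network_induced[OF assms]]
  show sub: "?K \<subseteq> R" using k_core_greatest(1)[OF fin] by simp
  show "k \<le> card (?K \<inter> neighbours N v)" if "v \<in> ?K"
    using k_core_greatest(2)[OF fin, of k] that sub assms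
    by (subst (asm) k_core_eq_induced) (simp add: min_degree_ge_induced)
  show "S \<subseteq> ?K" if "S \<subseteq> R" "\<And>v. v \<in> S \<Longrightarrow> k \<le> card (S \<inter> neighbours N v)"
    using k_core_greatest(3)[OF fin, of S k] that assms
    by (simp add: min_degree_ge_induced induced_induced)
qed

section \<open>Paths and connected components\<close>

lemma reachable_refl: "(u, u) \<in> reachable H"
  by (simp add: reachable_def)

lemma reachable_edge: "{u, v} \<in> edges H \<Longrightarrow> (u, v) \<in> reachable H"
  unfolding reachable_def by blast

lemma reachable_trans:
  "(u, v) \<in> reachable H \<Longrightarrow> (v, w) \<in> reachable H \<Longrightarrow> (u, w) \<in> reachable H"
  unfolding reachable_def by (rule rtrancl_trans)

lemma reachable_sym: "(u, v) \<in> reachable H \<Longrightarrow> (v, u) \<in> reachable H"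
proof -
  have "sym (reachable H)"
    unfolding reachable_def by (intro sym_rtrancl) (auto simp: sym_def insert_commute)
  then show "(u, v) \<in> reachable H \<Longrightarrow> (v, u) \<in> reachable H" by (meson symE)
qed

lemma reachable_closed:
  assumes "(u, v) \<in> reachable H" "u \<in> C"
    and closed: "\<And>x y. x \<in> C \<Longrightarrow> {x, y} \<in> edges H \<Longrightarrow> y \<in> C"
  shows "v \<in> C"
  using assms(1) unfolding reachable_def by induction (auto intro: assms)

text \<open>A path starting in \<open>C\<close> can never leave \<open>C\<close>, so only the edges
  of \<open>H\<close> at \<open>C\<close> have to survive in \<open>H'\<close>. This transfers
  connectivity between graphs that agree only locally.\<close>

lemma reachable_closed_subgraph:
  assumes "(u, v) \<in> reachable H" "u \<in> C"
    and closed: "\<And>x y. x \<in> C \<Longrightarrow> {x, y} \<in> edges H \<Longrightarrow> y \<in> C \<and> {x, y} \<in> edges H'"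
  shows "(u, v) \<in> reachable H'"
proof -
  have "v \<in> C \<and> (u, v) \<in> {(u, v). {u, v} \<in> edges H'}\<^sup>*"
    using assms(1) unfolding reachable_def
  proof induction
    case base
    then show ?case using assms(2) by simp
  next
    case (step y z)
    then show ?case using closed[of y z] by (auto intro: rtrancl_into_rtrancl)
  qed
  then show ?thesis by (simp add: reachable_def)
qed

lemma conn_component_closed:
  assumes "c \<in> conn_components H" "x \<in> c" "(x, y) \<in> reachable H" "y \<in> verts H"
  shows "y \<in> c"
proof -
  obtain u where c: "c = {v \<in> verts H. (u, v) \<in> reachable H}"
    using assms(1) unfolding conn_components_def by blast
  then have "(u, x) \<in> reachable H" using assms(2) by simp
  from reachable_trans[OF this assms(3)] show ?thesis using assms(4) by (simp add: c)
qed

lemma conn_component_reachable: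
  assumes "c \<in> conn_components H" "x \<in> c" "y \<in> c"
  shows "(x, y) \<in> reachable H"
proof -
  obtain u where c: "c = {v \<in> verts H. (u, v) \<in> reachable H}"
    using assms(1) unfolding conn_components_def by blast
  then have "(u, x) \<in> reachable H" "(u, y) \<in> reachable H" using assms(2,3) by simp_all
  from reachable_trans[OF reachable_sym[OF this(1)] this(2)] show ?thesis .
qed

text \<open>Closure under edges bounds the component of a vertex by its block, and connectivity
  inside the block gives the reverse inclusion.\<close>

lemma conn_components_eqI:
  assumes part: "partition_on (verts H) \<Gamma>"
    and closed: "\<And>c x y. c \<in> \<Gamma> \<Longrightarrow> x \<in> c \<Longrightarrow> {x, y} \<in> edges H \<Longrightarrow> y \<in> c"
    and conn: "\<And>c x y. c \<in> \<Gamma> \<Longrightarrow> x \<in> c \<Longrightarrow> y \<in> c \<Longrightarrow> (x, y) \<in> reachable H"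
  shows "conn_components H = \<Gamma>"
proof -
  have c: "{v \<in> verts H. (u, v) \<in> reachable H} = c" if "c \<in> \<Gamma>" "u \<in> c" for c u
  proof
    show "{v \<in> verts H. (u, v) \<in> reachable H} \<subseteq> c"
      using reachable_closed[of u _ H c] closed that by blast
    show "c \<subseteq> {v \<in> verts H. (u, v) \<in> reachable H}"
      using conn that part unfolding partition_on_def by blast
  qed
  have V: "\<Union>\<Gamma> = verts H" and ne: "{} \<notin> \<Gamma>" using part by (auto simp: partition_on_def)
  show ?thesis
  proof (intro equalityI subsetI)
    fix d assume "d \<in> conn_components H"
    then obtain u where "d = {v \<in> verts H. (u, v) \<in> reachable H}" "u \<in> verts H"
      unfolding conn_components_def by blast
    moreover from this obtain e where "e \<in> \<Gamma>" "u \<in> e" using V by blast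
    ultimately show "d \<in> \<Gamma>" using c[of e u] by simp
  next
    fix d assume d: "d \<in> \<Gamma>"
    then obtain u where u: "u \<in> d" using ne by fastforce
    then have "u \<in> verts H" using d V by blast
    then show "d \<in> conn_components H"
      unfolding conn_components_def using c[OF d u] by blast
  qed
qed

section \<open>Level functions\<close>

text \<open>The level differs from the usual core number: a pendant vertex attached to a triangle
  has core number 1 but level 0, because its neighbour is removed first. In the second condition
  \<open>k\<close> may exceed every level in \<open>S\<close>; the conclusion then forces
  \<open>S\<close> to be empty, so the condition also bounds the core orders that can occur.\<close>

definition core_levels :: "'a graph \<Rightarrow> ('a \<Rightarrow> nat) \<Rightarrow> bool" where
  "core_levels N \<kappa> \<longleftrightarrow>
     (\<forall>v\<in>verts N. \<kappa> v \<le> card {u \<in> neighbours N v. \<kappa> u = \<kappa> v}) \<and>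
     (\<forall>S k. S \<subseteq> verts N \<longrightarrow> (\<forall>v\<in>S. \<kappa> v \<le> k \<and> k \<le> card (S \<inter> neighbours N v)) \<longrightarrow>
        (\<forall>v\<in>S. \<kappa> v = k))"

definition level_graph :: "'a graph \<Rightarrow> ('a \<Rightarrow> nat) \<Rightarrow> 'a graph" where
  "level_graph N \<kappa> = (verts N, {e \<in> edges N. \<forall>u\<in>e. \<forall>v\<in>e. \<kappa> u = \<kappa> v})"

lemma verts_level_graph [simp]: "verts (level_graph N \<kappa>) = verts N"
  by (simp add: level_graph_def)

lemma core_levels_D1:
  "core_levels N \<kappa> \<Longrightarrow> v \<in> verts N \<Longrightarrow> \<kappa> v \<le> card {u \<in> neighbours N v. \<kappa> u = \<kappa> v}"
  by (simp add: core_levels_def)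

lemma core_levels_D2:
  "core_levels N \<kappa> \<Longrightarrow> S \<subseteq> verts N \<Longrightarrow> (\<And>v. v \<in> S \<Longrightarrow> \<kappa> v \<le> k) \<Longrightarrow>
    (\<And>v. v \<in> S \<Longrightarrow> k \<le> card (S \<inter> neighbours N v)) \<Longrightarrow> v \<in> S \<Longrightarrow> \<kappa> v = k"
  by (simp add: core_levels_def)

text \<open>Induction on the number of vertices, following one round of the algorithm: the maximal
  core \<open>K\<close> gets its order \<open>k\<close> as level, and the remaining vertices keep
  the levels of the graph induced on them.\<close>

lemma core_levels_exists:
  assumes "network N"
  shows "\<exists>\<kappa>. core_levels N \<kappa>"
  using assms
proof (induction "card (verts N)" arbitrary: N rule: less_induct)
  case less
  note net = less.prems
  show ?case
  proof (cases "verts N = {}")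
    case True
    then show ?thesis by (auto simp: core_levels_def)
  next
    case False
    define k where "k = max_core_number N"
    define K where "K = verts (k_core k N)"
    define R where "R = verts N - K"
    note core = k_core_induced[OF net order_refl, unfolded induced_verts[OF net]]
    have KV: "K \<subseteq> verts N" unfolding K_def by (rule core(1))
    have Kne: "K \<noteq> {}" and max: "\<And>m. verts (k_core m N) \<noteq> {} \<Longrightarrow> m \<le> k"
      using max_core_nonempty[OF network_finite_edges[OF net] False]
      by (simp_all add: K_def k_def max_core_def)
    have Kdeg: "k \<le> card (K \<inter> neighbours N v)" if "v \<in> K" for v
      using core(2) that unfolding K_def .
    have RV: "R \<subseteq> verts N" by (simp add: R_def)
    have fin: "finite (verts N)" using net by (simp add: network_def)
    have "card R < card (verts N)"
      using KV Kne fin unfolding R_def by (intro psubset_card_mono) auto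
    then obtain \<kappa>' where k': "core_levels (induced N R) \<kappa>'"
      using less.hyps[of "induced N R"] network_induced[OF net RV] by auto
    \<comment> \<open>Levels strictly decrease from round to round: a level set of the remainder
      with level at least \<open>k\<close> would span minimum degree \<open>k\<close>, and so would
      already lie in the \<open>k\<close>-core \<open>K\<close>, which is disjoint from
      \<open>R\<close>.\<close>
    have low: "\<kappa>' v < k" if v: "v \<in> R" for v
    proof (rule ccontr)
      assume nl: "\<not> \<kappa>' v < k"
      let ?S = "{u \<in> R. \<kappa>' u = \<kappa>' v}"
      have "k \<le> card (?S \<inter> neighbours N w)" if "w \<in> ?S" for w
      proof -
        have "k \<le> \<kappa>' w" using nl that by simp
        also have "\<dots> \<le> card {u \<in> neighbours (induced N R) w. \<kappa>' u = \<kappa>' w}"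
          using core_levels_D1[OF k', of w] that by simp
        also have "{u \<in> neighbours (induced N R) w. \<kappa>' u = \<kappa>' w} = ?S \<inter> neighbours N w"
          using that by (auto simp: neighbours_induced)
        finally show ?thesis .
      qed
      then have "?S \<subseteq> K" unfolding K_def using RV by (intro core(3)) auto
      then show False using v by (auto simp: R_def)
    qed
    define \<kappa> where "\<kappa> = (\<lambda>v. if v \<in> K then k else \<kappa>' v)"
    have inR: "\<kappa> v = \<kappa>' v" if "v \<in> R" for v using that by (auto simp: \<kappa>_def R_def)
    have inK: "\<kappa> v = k" if "v \<in> K" for v using that by (simp add: \<kappa>_def)
    have VKR: "v \<in> K \<or> v \<in> R" if "v \<in> verts N" for v using that by (auto simp: R_def)
    have "core_levels N \<kappa>"
      unfolding core_levels_def
    proof (intro conjI ballI allI impI)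
      fix v assume v: "v \<in> verts N"
      show "\<kappa> v \<le> card {u \<in> neighbours N v. \<kappa> u = \<kappa> v}"
      proof (cases "v \<in> K")
        case True
        have "k \<le> card (K \<inter> neighbours N v)" using Kdeg True .
        also have "\<dots> \<le> card {u \<in> neighbours N v. \<kappa> u = \<kappa> v}"
          using finite_neighbours[OF net] True by (intro card_mono) (auto simp: inK)
        finally show ?thesis using True by (simp add: inK)
      next
        case False
        then have vR: "v \<in> R" using v VKR by blast
        have "\<kappa> v \<le> card {u \<in> neighbours (induced N R) v. \<kappa>' u = \<kappa>' v}"
          using core_levels_D1[OF k', of v] vR by (simp add: inR)
        also have "\<dots> \<le> card {u \<in> neighbours N v. \<kappa> u = \<kappa> v}"
          using finite_neighbours[OF net] vR
          by (intro card_mono) (auto simp: inR neighbours_induced)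
        finally show ?thesis .
      qed
    next
      fix S m v
      assume S: "S \<subseteq> verts N" "\<forall>v\<in>S. \<kappa> v \<le> m \<and> m \<le> card (S \<inter> neighbours N v)" and v: "v \<in> S"
      \<comment> \<open>A nonempty set of minimum degree \<open>m\<close> witnesses a nonempty
        \<open>m\<close>-core, and \<open>k\<close> is the largest such order.\<close>
      have Sm: "S \<subseteq> verts (k_core m N)" using S by (intro core(3)) auto
      then have mk: "m \<le> k" using v by (intro max) blast
      show "\<kappa> v = m"
      proof (cases "S \<inter> K = {}")
        case True
        then have SR: "S \<subseteq> R" using S by (auto simp: R_def)
        have "\<kappa>' v = m"
        proof (rule core_levels_D2[OF k' _ _ _ v])
          fix w assume w: "w \<in> S"
          have "S \<inter> neighbours (induced N R) w = S \<inter> neighbours N w"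
            using w SR by (subst neighbours_induced) auto
          then show "m \<le> card (S \<inter> neighbours (induced N R) w)" using S w by simp
          have "\<kappa>' w = \<kappa> w" using w SR inR by force
          then show "\<kappa>' w \<le> m" using S(2) w by simp
        qed (use SR in simp)
        then show ?thesis using SR v inR by auto
      next
        case False
        \<comment> \<open>A vertex of \<open>S\<close> in \<open>K\<close> has level
          \<open>k\<close>, which is at most \<open>m\<close>. Hence \<open>m = k\<close>, and
          \<open>S\<close> lies in the \<open>k\<close>-core, which is \<open>K\<close>.\<close>
        then have "k \<le> m" using S inK by force
        then have "m = k" using mk by simp
        then show ?thesis using Sm v inK by (auto simp: K_def)
      qed
    qed
    then show ?thesis by blast
  qed
qed

section \<open>The removal loop in terms of levels\<close>

text \<open>The second condition of \<open>core_levels\<close>, applied to the core itself, puts it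
  inside level \<open>k\<close>; by the first condition the level set has minimum degree
  \<open>k\<close> and so lies in the core.\<close>

lemma k_core_below_level:
  assumes net: "network N" and lev: "core_levels N \<kappa>"
    and R: "R = {v \<in> verts N. \<kappa> v \<le> k}"
  shows "verts (k_core k (induced N R)) = {v \<in> verts N. \<kappa> v = k}"
proof
  have RV: "R \<subseteq> verts N" by (auto simp: R)
  note core = k_core_induced[OF net RV]
  show "verts (k_core k (induced N R)) \<subseteq> {v \<in> verts N. \<kappa> v = k}"
  proof
    fix v assume v: "v \<in> verts (k_core k (induced N R))"
    have "\<kappa> v = k"
      by (rule core_levels_D2[OF lev _ _ _ v]) (use core(1)[of k] core(2)[of _ k] in \<open>auto simp: R\<close>)
    then show "v \<in> {v \<in> verts N. \<kappa> v = k}" using v core(1)[of k] RV by auto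
  qed
  show "{v \<in> verts N. \<kappa> v = k} \<subseteq> verts (k_core k (induced N R))"
  proof (rule core(3))
    fix v assume v: "v \<in> {v \<in> verts N. \<kappa> v = k}"
    have "{u \<in> neighbours N v. \<kappa> u = \<kappa> v} = {v \<in> verts N. \<kappa> v = k} \<inter> neighbours N v"
      using v neighbours_subset[OF net, of v] by auto
    then show "k \<le> card ({v \<in> verts N. \<kappa> v = k} \<inter> neighbours N v)"
      using core_levels_D1[OF lev, of v] v by simp
  qed (auto simp: R)
qed

text \<open>An occupied level \<open>k\<close> makes the \<open>k\<close>-core nonempty, so the
  maximal order is at least \<open>k\<close>. Conversely, all levels in the maximal core are at most
  \<open>k\<close>, while the second condition makes them equal to its order.\<close>

lemma max_core_below_level:
  assumes net: "network N" and lev: "core_levels N \<kappa>"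
    and R: "R = {v \<in> verts N. \<kappa> v \<le> k}" and top: "\<exists>v\<in>verts N. \<kappa> v = k"
  shows "max_core (induced N R) = induced N {v \<in> verts N. \<kappa> v = k}"
proof -
  have RV: "R \<subseteq> verts N" by (auto simp: R)
  note fin = network_finite_edges[OF network_induced[OF net RV]]
  have ne: "verts (induced N R) \<noteq> {}" using top by (auto simp: R)
  let ?m = "max_core_number (induced N R)"
  have "k \<le> ?m"
    using top by (auto simp: max_core_nonempty(2)[OF fin ne] k_core_below_level[OF net lev R])
  moreover have "?m \<le> k"
  proof -
    let ?S = "verts (k_core ?m (induced N R))"
    obtain v where v: "v \<in> ?S" using max_core_nonempty(1)[OF fin ne] by (auto simp: max_core_def)
    have vR: "w \<in> R" if "w \<in> ?S" for w using that k_core_induced(1)[OF net RV] by blast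
    have "\<kappa> v = ?m"
    proof (rule core_levels_D2[OF lev _ _ _ v])
      show "?S \<subseteq> verts N" using vR RV by blast
      show "\<kappa> w \<le> ?m" if "w \<in> ?S" for w using vR[OF that] \<open>k \<le> ?m\<close> by (simp add: R)
      show "?m \<le> card (?S \<inter> neighbours N w)" if "w \<in> ?S" for w
        using k_core_induced(2)[OF net RV that] .
    qed
    then show ?thesis using vR[OF v] by (simp add: R)
  qed
  ultimately have "?m = k" by simp
  then show ?thesis
    unfolding max_core_def by (metis k_core_eq_induced k_core_below_level[OF net lev R])
qed

lemma level_graph_edge:
  assumes "network N" "{x, y} \<in> edges (level_graph N \<kappa>)"
  shows "x \<in> verts N" "y \<in> verts N" "\<kappa> x = \<kappa> y" "{x, y} \<in> edges N"
proof -
  show e: "{x, y} \<in> edges N" using assms(2) unfolding level_graph_def snd_conv by blast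
  show "x \<in> verts N" "y \<in> verts N" using assms(1) e unfolding network_def by blast+
  show "\<kappa> x = \<kappa> y" using assms(2) unfolding level_graph_def snd_conv by blast
qed

lemma level_graph_edgeI:
  "{x, y} \<in> edges N \<Longrightarrow> \<kappa> x = \<kappa> y \<Longrightarrow> {x, y} \<in> edges (level_graph N \<kappa>)"
  by (simp add: level_graph_def)

text \<open>Edges of the level graph never leave a level, so paths inside the induced subgraph and
  paths in the level graph coincide. The right-hand side depends on \<open>k\<close> only through
  the choice of \<open>u\<close>, which lets the loop invariant collect several levels in one
  set.\<close>

lemma conn_components_level:
  assumes net: "network N"
  shows "conn_components (induced N {v \<in> verts N. \<kappa> v = k}) =
    {{w \<in> verts N. (u, w) \<in> reachable (level_graph N \<kappa>)} | u. u \<in> verts N \<and> \<kappa> u = k}"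
proof -
  let ?L = "level_graph N \<kappa>" and ?C = "{v \<in> verts N. \<kappa> v = k}"
  let ?I = "induced N ?C"
  have "{v \<in> ?C. (u, v) \<in> reachable ?I} = {w \<in> verts N. (u, w) \<in> reachable ?L}" if "u \<in> ?C" for u
  proof (intro equalityI subsetI)
    fix v assume v: "v \<in> {v \<in> ?C. (u, v) \<in> reachable ?I}"
    then have "(u, v) \<in> reachable ?I" by simp
    then have "(u, v) \<in> reachable ?L"
      by (rule reachable_closed_subgraph[OF _ that]) (auto simp: induced_def level_graph_def)
    then show "v \<in> {w \<in> verts N. (u, w) \<in> reachable ?L}" using v by simp
  next
    fix v assume v: "v \<in> {w \<in> verts N. (u, w) \<in> reachable ?L}"
    then have r: "(u, v) \<in> reachable ?L" by simp
    have cl: "y \<in> ?C" if "x \<in> ?C" "{x, y} \<in> edges ?L" for x y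
      using level_graph_edge[OF net that(2)] that(1) by simp
    have "v \<in> ?C" by (rule reachable_closed[OF r that cl])
    moreover have "(u, v) \<in> reachable ?I"
    proof (rule reachable_closed_subgraph[OF r that])
      fix x y assume "x \<in> ?C" "{x, y} \<in> edges ?L"
      then show "y \<in> ?C \<and> {x, y} \<in> edges ?I"
        using cl[of x y] level_graph_edge(4)[OF net, of x y] by (simp add: induced_def)
    qed
    ultimately show "v \<in> {v \<in> ?C. (u, v) \<in> reachable ?I}" by simp
  qed
  then show ?thesis unfolding conn_components_def verts_induced
    by (intro Collect_cong ex_cong1) auto
qed

text \<open>The loop invariant \<open>?I\<close> uses a threshold \<open>m\<close>: the vertices
  below \<open>m\<close> remain, and the level components of all vertices at or above
  \<open>m\<close> have been output. Each round lowers the threshold to the largest level still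
  present.\<close>

theorem ikc_nomod_eq_level_components:
  assumes net: "network N" and lev: "core_levels N \<kappa>"
  shows "ikc_nomod N = conn_components (level_graph N \<kappa>)"
proof -
  let ?c = "\<lambda>u. {w \<in> verts N. (u, w) \<in> reachable (level_graph N \<kappa>)}"
  let ?b = "\<lambda>(R, \<Gamma> :: 'a set set). R \<noteq> ({} :: 'a set)"
  let ?s = "\<lambda>(R, \<Gamma>). (R - verts (max_core (induced N R)),
                  \<Gamma> \<union> conn_components (max_core (induced N R)))"
  let ?I = "\<lambda>(R, \<Gamma>). \<exists>m. R = {v \<in> verts N. \<kappa> v < m} \<and> \<Gamma> = {?c u | u. u \<in> verts N \<and> m \<le> \<kappa> u}"
  have fin: "finite (verts N)" using net by (simp add: network_def)
  have step: "\<exists>k. R - verts (max_core (induced N R)) = {v \<in> verts N. \<kappa> v < k} \<and>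
      R - verts (max_core (induced N R)) \<subset> R \<and>
      \<Gamma> \<union> conn_components (max_core (induced N R)) = {?c u | u. u \<in> verts N \<and> k \<le> \<kappa> u}"
    if R: "R = {v \<in> verts N. \<kappa> v < m}" and G: "\<Gamma> = {?c u | u. u \<in> verts N \<and> m \<le> \<kappa> u}"
      and ne: "R \<noteq> {}" for R \<Gamma> m
  proof -
    define k where "k = Max (\<kappa> ` R)"
    have finR: "finite R" using fin R by simp
    have "k \<in> \<kappa> ` R" unfolding k_def using finR ne by (intro Max_in) auto
    then have top: "\<exists>v\<in>verts N. \<kappa> v = k" and km: "k < m" using R by auto
    have le: "\<kappa> v \<le> k" if "v \<in> R" for v unfolding k_def using finR that by simp
    have Rk: "R = {v \<in> verts N. \<kappa> v \<le> k}" using le km by (auto simp: R)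
    \<comment> \<open>No vertex has a level strictly between \<open>k\<close> and \<open>m\<close>,
      so adding level \<open>k\<close> to the output accounts for every level from \<open>k\<close>
      upwards.\<close>
    have gap: "k \<le> \<kappa> u \<longleftrightarrow> m \<le> \<kappa> u \<or> \<kappa> u = k" if "u \<in> verts N" for u
      using le[of u] km that unfolding R by force
    have mc: "max_core (induced N R) = induced N {v \<in> verts N. \<kappa> v = k}"
      by (rule max_core_below_level[OF net lev Rk top])
    show ?thesis
      unfolding mc verts_induced conn_components_level[OF net] G
    proof (intro exI[of _ k] conjI)
      show "R - {v \<in> verts N. \<kappa> v = k} = {v \<in> verts N. \<kappa> v < k}" by (auto simp: Rk)
      show "R - {v \<in> verts N. \<kappa> v = k} \<subset> R" using top by (auto simp: Rk)
    qed (use gap in blast)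
  qed
  have "?I (while ?b ?s (verts N, {})) \<and> \<not> ?b (while ?b ?s (verts N, {}))"
  proof (rule while_rule[where P = ?I and r = "measure (\<lambda>(R, \<Gamma>). card (R \<inter> verts N))"], goal_cases)
    case 1
    \<comment> \<open>The initial threshold is one above the largest level, so all vertices remain
      and nothing has been output.\<close>
    have "\<kappa> v < Suc (Max (\<kappa> ` verts N))" if "v \<in> verts N" for v
      using fin that by (simp add: less_Suc_eq_le)
    then show ?case by (auto intro!: exI[of _ "Suc (Max (\<kappa> ` verts N))"] dest: leD)
  next
    case (2 s)
    obtain R \<Gamma> where s: "s = (R, \<Gamma>)" by force
    obtain m where m: "R = {v \<in> verts N. \<kappa> v < m}" "\<Gamma> = {?c u | u. u \<in> verts N \<and> m \<le> \<kappa> u}"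
      using 2 unfolding s by auto
    have "R \<noteq> {}" using 2 unfolding s by simp
    from step[OF m this] show ?case unfolding s prod.case by blast
  next
    case (3 s)
    then show ?case by (cases s) auto
  next
    case 4
    show ?case by simp
  next
    case (5 s)
    obtain R \<Gamma> where s: "s = (R, \<Gamma>)" by force
    obtain m where m: "R = {v \<in> verts N. \<kappa> v < m}" "\<Gamma> = {?c u | u. u \<in> verts N \<and> m \<le> \<kappa> u}"
      using 5 unfolding s by auto
    have "R \<noteq> {}" using 5 unfolding s by simp
    from step[OF m this] have "R - verts (max_core (induced N R)) \<subset> R" by (elim exE conjE)
    then have "(R - verts (max_core (induced N R))) \<inter> verts N \<subset> R \<inter> verts N"
      using m(1) by blast
    then show ?case using fin unfolding s by (auto intro: psubset_card_mono)
  qed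
  then obtain m where "{v \<in> verts N. \<kappa> v < m} = {}"
    and eq: "ikc_nomod N = {?c u | u. u \<in> verts N \<and> m \<le> \<kappa> u}"
    unfolding ikc_nomod_def by (auto split: prod.splits)
  \<comment> \<open>Once no vertex lies below the threshold, the restriction to levels at least
    \<open>m\<close> is vacuous and all level components are present.\<close>
  then have "\<And>u. u \<in> verts N \<Longrightarrow> m \<le> \<kappa> u" by (auto simp: not_less)
  then show ?thesis unfolding eq conn_components_def by auto
qed

section \<open>The axioms that hold\<close>

text \<open>The ends of such an edge are reachable from each other and therefore share a component.
  Deleting edges between clusters thus never touches the level graph.\<close>

lemma level_edge_not_inter_pair:
  assumes net: "network N" and e: "e \<in> edges (level_graph N \<kappa>)"
  shows "e \<notin> inter_pairs (conn_components (level_graph N \<kappa>))"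
proof
  let ?L = "level_graph N \<kappa>"
  assume "e \<in> inter_pairs (conn_components ?L)"
  then obtain u v c d where uv: "e = {u, v}" "c \<in> conn_components ?L" "d \<in> conn_components ?L"
      "c \<noteq> d" "u \<in> c" "v \<in> d"
    unfolding inter_pairs_def by blast
  have "(u, v) \<in> reachable ?L" using e uv(1) by (auto intro: reachable_edge)
  moreover have "v \<in> verts N" using level_graph_edge(2)[OF net] e uv(1) by blast
  ultimately have "v \<in> c"
    using conn_component_closed[OF uv(2,5)] by simp
  then show False
    using uv conn_components_partition[of ?L] unfolding partition_on_def disjoint_def by blast
qed

lemma ikc_nomod_inter_edge_consistency: "inter_edge_consistency ikc_nomod"
  unfolding inter_edge_consistency_def
proof (intro allI impI)
  fix V :: "'a set" and E E'
  assume net: "network (V, E)" and net': "network (V, E')"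
    and ch: "inter_edge_change (ikc_nomod (V, E)) E E'"
  obtain \<kappa> where lev: "core_levels (V, E) \<kappa>" using core_levels_exists[OF net] by blast
  note ikc = ikc_nomod_eq_level_components[OF net lev]
  have sub: "E' \<subseteq> E" and keep: "edges (level_graph (V, E) \<kappa>) \<subseteq> E'"
    using ch level_edge_not_inter_pair[OF net, of _ \<kappa>]
    unfolding inter_edge_change_def ikc level_graph_def fst_conv snd_conv by blast+
  have same: "level_graph (V, E') \<kappa> = level_graph (V, E) \<kappa>"
    using sub keep unfolding level_graph_def fst_conv snd_conv by blast
  have "core_levels (V, E') \<kappa>"
    unfolding core_levels_def
  proof (intro conjI ballI allI impI)
    fix v assume v: "v \<in> verts (V, E')"
    \<comment> \<open>Only edges of the level graph count here, and all of them survive the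
      deletion.\<close>
    have "{u \<in> neighbours (V, E') v. \<kappa> u = \<kappa> v} = {u \<in> neighbours (V, E) v. \<kappa> u = \<kappa> v}"
      using sub keep level_graph_edgeI[of _ v "(V, E)" \<kappa>] unfolding neighbours_def by auto
    then show "\<kappa> v \<le> card {u \<in> neighbours (V, E') v. \<kappa> u = \<kappa> v}"
      using core_levels_D1[OF lev, of v] v by simp
  next
    fix S k v
    assume S: "S \<subseteq> verts (V, E')"
      "\<forall>v\<in>S. \<kappa> v \<le> k \<and> k \<le> card (S \<inter> neighbours (V, E') v)" and v: "v \<in> S"
    show "\<kappa> v = k"
    proof (rule core_levels_D2[OF lev _ _ _ v])
      \<comment> \<open>Deletion only shrinks neighbourhoods, so a set of minimum degree
        \<open>k\<close> after the deletion had it before.\<close>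
      fix w assume "w \<in> S"
      then have "k \<le> card (S \<inter> neighbours (V, E') w)" using S by blast
      also have "\<dots> \<le> card (S \<inter> neighbours (V, E) w)"
        using sub finite_neighbours[OF net] by (intro card_mono) (auto simp: neighbours_def)
      finally show "k \<le> card (S \<inter> neighbours (V, E) w)" .
    qed (use S in auto)
  qed
  then show "ikc_nomod (V, E') = ikc_nomod (V, E)"
    using ikc_nomod_eq_level_components[OF net'] ikc same by simp
qed

section \<open>Fixed Point for unions of level components\<close>

text \<open>The same \<open>\<kappa>\<close> certifies the subgraph induced on \<open>U\<close>: as
  a union of level components, \<open>U\<close> contains all same-level neighbours of its vertices,
  and for \<open>S \<subseteq> U\<close> the degrees inside \<open>S\<close> do not change.\<close>

lemma ikc_nomod_fixed_point: "fixed_point ikc_nomod"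
  unfolding fixed_point_def
proof (intro allI impI)
  fix N :: "'a graph" and \<D>
  assume net: "network N" and D: "\<D> \<subseteq> ikc_nomod N"
  define U where "U = \<Union>\<D>"
  obtain \<kappa> where lev: "core_levels N \<kappa>" using core_levels_exists[OF net] by blast
  let ?L = "level_graph N \<kappa>"
  note part = conn_components_partition[of ?L]
  have DC: "\<D> \<subseteq> conn_components ?L"
    using D ikc_nomod_eq_level_components[OF net lev] by simp
  have UV: "U \<subseteq> verts N" using DC part unfolding U_def partition_on_def by auto
  have closed: "y \<in> c" if "c \<in> \<D>" "x \<in> c" "{x, y} \<in> edges ?L" for c x y
  proof -
    have "c \<in> conn_components ?L" using that(1) DC by blast
    then show ?thesis
      using conn_component_closed[OF _ that(2) reachable_edge[OF that(3)]]
        level_graph_edge(2)[OF net that(3)] by simp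
  qed
  have closedU: "y \<in> U" if "x \<in> U" "{x, y} \<in> edges ?L" for x y
    using that closed unfolding U_def by blast
  let ?N = "induced N U" and ?L' = "level_graph (induced N U) \<kappa>"
  have "core_levels ?N \<kappa>"
    unfolding core_levels_def verts_induced
  proof (intro conjI ballI allI impI)
    fix v assume v: "v \<in> U"
    have "{u \<in> neighbours ?N v. \<kappa> u = \<kappa> v} = {u \<in> neighbours N v. \<kappa> u = \<kappa> v}"
      using closedU[OF v] v level_graph_edgeI[of v _ N \<kappa>]
      by (subst neighbours_induced) (auto simp: neighbours_def insert_commute)
    then show "\<kappa> v \<le> card {u \<in> neighbours ?N v. \<kappa> u = \<kappa> v}"
      using core_levels_D1[OF lev, of v] v UV by auto
  next
    fix S k v
    assume S: "S \<subseteq> U" "\<forall>v\<in>S. \<kappa> v \<le> k \<and> k \<le> card (S \<inter> neighbours ?N v)" and v: "v \<in> S"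
    show "\<kappa> v = k"
    proof (rule core_levels_D2[OF lev _ _ _ v])
      fix w assume w: "w \<in> S"
      have "S \<inter> neighbours ?N w = S \<inter> neighbours N w"
        using w S by (subst neighbours_induced) auto
      then show "k \<le> card (S \<inter> neighbours N w)" using S w by fastforce
    qed (use S UV in auto)
  qed
  then have "ikc_nomod ?N = conn_components ?L'"
    using ikc_nomod_eq_level_components network_induced[OF net UV] by blast
  also have "\<dots> = \<D>"
  proof (rule conn_components_eqI)
    show "partition_on (verts ?L') \<D>"
      using part DC pairwise_mono[of disjnt "conn_components ?L" disjnt \<D>]
      unfolding partition_on_def by (auto simp: U_def)
  next
    fix c x y assume "c \<in> \<D>" "x \<in> c" "{x, y} \<in> edges ?L'"
    moreover have "edges ?L' \<subseteq> edges ?L"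
      unfolding level_graph_def induced_def fst_conv snd_conv by blast
    ultimately show "y \<in> c" using closed[of c x y] by blast
  next
    fix c x y assume c: "c \<in> \<D>" "x \<in> c" "y \<in> c"
    have "c \<in> conn_components ?L" using c(1) DC by blast
    then have "(x, y) \<in> reachable ?L"
      using conn_component_reachable c(2,3) by metis
    moreover have "x \<in> U" using c by (auto simp: U_def)
    ultimately show "(x, y) \<in> reachable ?L'"
    proof (rule reachable_closed_subgraph)
      fix a b assume ab: "a \<in> U" "{a, b} \<in> edges ?L"
      have "b \<in> U" by (rule closedU[OF ab])
      moreover have "{a, b} \<in> edges ?L'"
        using level_graph_edge(3,4)[OF net ab(2)] ab(1) \<open>b \<in> U\<close>
        by (intro level_graph_edgeI) (simp_all add: induced_def)
      ultimately show "b \<in> U \<and> {a, b} \<in> edges ?L'" ..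
    qed
  qed
  finally show "ikc_nomod (induced N (\<Union>\<D>)) = \<D>" by (simp add: U_def)
qed

section \<open>Richness from disjoint cliques\<close>

lemma neighbours_intra_pairs:
  assumes "partition_on V \<Gamma>" "c \<in> \<Gamma>" "v \<in> c"
  shows "neighbours (V, intra_pairs \<Gamma>) v = c - {v}"
  using assms unfolding partition_on_def disjoint_def neighbours_def intra_pairs_def
  by (auto simp: doubleton_eq_iff)

lemma network_intra_pairs:
  assumes "finite V" "\<Union>\<Gamma> \<subseteq> V"
  shows "network (V, intra_pairs \<Gamma>)"
  using assms unfolding network_def intra_pairs_def by (auto simp: card_2_iff)

text \<open>Take a clique on every block and let the level of a vertex be its degree, one less than
  the size of its block. Blocks of equal size share a level but stay separate, since no edge joins
  them.\<close>

lemma ikc_nomod_richness: "richness ikc_nomod"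
  unfolding richness_def
proof (intro allI impI)
  fix V :: "'a set" and \<Gamma>
  assume fin: "finite V" and part: "partition_on V \<Gamma>"
  let ?N = "(V, intra_pairs \<Gamma>)"
  have net: "network ?N" using fin part by (intro network_intra_pairs) (auto simp: partition_on_def)
  define \<kappa> where "\<kappa> = (\<lambda>v. card (neighbours ?N v))"
  have same: "\<kappa> x = \<kappa> y" if "c \<in> \<Gamma>" "x \<in> c" "y \<in> c" for c x y
    using that neighbours_intra_pairs[OF part] by (simp add: \<kappa>_def card_Diff_singleton)
  have nb: "\<kappa> u = \<kappa> v" if "u \<in> neighbours ?N v" for u v
    using that same[of _ u v] unfolding neighbours_def intra_pairs_def
    by (auto simp: doubleton_eq_iff)
  have "core_levels ?N \<kappa>"
    unfolding core_levels_def
  proof (intro conjI ballI allI impI)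
    fix v
    have "{u \<in> neighbours ?N v. \<kappa> u = \<kappa> v} = neighbours ?N v" using nb by blast
    then show "\<kappa> v \<le> card {u \<in> neighbours ?N v. \<kappa> u = \<kappa> v}" by (simp add: \<kappa>_def)
  next
    fix S k v
    assume "\<forall>v\<in>S. \<kappa> v \<le> k \<and> k \<le> card (S \<inter> neighbours ?N v)" "v \<in> S"
    \<comment> \<open>This closes the chain from \<open>\<kappa> v\<close> through \<open>k\<close>
      and the degree in \<open>S\<close> back to \<open>\<kappa> v\<close>.\<close>
    moreover have "card (S \<inter> neighbours ?N v) \<le> \<kappa> v"
      unfolding \<kappa>_def using finite_neighbours[OF net] by (intro card_mono) auto
    ultimately show "\<kappa> v = k" by force
  qed
  then have "ikc_nomod ?N = conn_components (level_graph ?N \<kappa>)"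
    by (rule ikc_nomod_eq_level_components[OF net])
  also have "\<dots> = \<Gamma>"
  proof (rule conn_components_eqI)
    show "partition_on (verts (level_graph ?N \<kappa>)) \<Gamma>" using part by simp
  next
    fix c x y assume c: "c \<in> \<Gamma>" "x \<in> c" "{x, y} \<in> edges (level_graph ?N \<kappa>)"
    then have "y \<in> neighbours ?N x"
      using level_graph_edge(4)[OF net] by (simp add: neighbours_def insert_commute)
    then show "y \<in> c" using neighbours_intra_pairs[OF part c(1,2)] by simp
  next
    fix c x y assume c: "c \<in> \<Gamma>" "x \<in> c" "y \<in> c"
    show "(x, y) \<in> reachable (level_graph ?N \<kappa>)"
    proof (cases "x = y")
      case False
      then have "{x, y} \<in> edges (level_graph ?N \<kappa>)"
        using c same[OF c] by (intro level_graph_edgeI) (auto simp: intra_pairs_def)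
      then show ?thesis by (rule reachable_edge)
    qed (simp add: reachable_refl)
  qed
  finally show "\<exists>E. network (V, E) \<and> ikc_nomod (V, E) = \<Gamma>" using net by blast
qed

section \<open>The axioms that fail\<close>

text \<open>Both counterexamples have the vertex set \<open>A \<union> B\<close> and the bridge
  between \<open>a\<close> and \<open>b\<close>, with a clique on \<open>A\<close>; they differ only
  in whether \<open>B\<close> carries a clique or a star.\<close>

locale joined_sets =
  fixes A B :: "'a set" and a b :: 'a
  assumes fin: "finite A" "finite B" and disj: "A \<inter> B = {}" and ab: "a \<in> A" "b \<in> B"
begin

section \<open>Two cliques joined by a bridge\<close>

definition bicliques :: "'a graph" where
  "bicliques = (A \<union> B, insert {a, b} (intra_pairs {A, B}))"

lemma network_bicliques: "network bicliques"
proof -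
  have "network (A \<union> B, intra_pairs {A, B})" using fin by (intro network_intra_pairs) auto
  moreover have "a \<noteq> b" using disj ab by auto
  ultimately show ?thesis using ab by (auto simp: bicliques_def network_def)
qed

lemma neighbours_bicliques:
  "v \<in> A \<Longrightarrow> neighbours bicliques v = (A - {v}) \<union> (if v = a then {b} else {})"
  "v \<in> B \<Longrightarrow> neighbours bicliques v = (B - {v}) \<union> (if v = b then {a} else {})"
  using disj ab unfolding neighbours_def bicliques_def intra_pairs_def
  by (auto simp: doubleton_eq_iff)

lemma bicliques_edge:
  assumes "x \<noteq> y" "x \<in> A \<and> y \<in> A \<or> x \<in> B \<and> y \<in> B"
  shows "{x, y} \<in> edges bicliques"
  using assms unfolding bicliques_def intra_pairs_def by auto

lemma conn_components_bicliques: "conn_components bicliques = {A \<union> B}"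
proof (rule conn_components_eqI)
  show "partition_on (verts bicliques) {A \<union> B}"
    using ab by (auto simp: partition_on_def bicliques_def)
next
  fix c x y assume "c \<in> {A \<union> B}" "x \<in> c" "{x, y} \<in> edges bicliques"
  then show "y \<in> c" using network_bicliques by (auto simp: network_def bicliques_def)
next
  have join: "(a, b) \<in> reachable bicliques" by (rule reachable_edge) (simp add: bicliques_def)
  have "(a, x) \<in> reachable bicliques" if "x \<in> A \<union> B" for x
  proof (cases "x \<in> A")
    case True
    then show ?thesis using bicliques_edge[of a x] ab reachable_edge reachable_refl by metis
  next
    case False
    then have "(b, x) \<in> reachable bicliques"
      using that bicliques_edge[of b x] ab reachable_edge reachable_refl by (metis Un_iff)
    then show ?thesis using join reachable_trans by metis
  qed
  then show "(x, y) \<in> reachable bicliques" if "c \<in> {A \<union> B}" "x \<in> c" "y \<in> c" for c x y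
    using that reachable_sym reachable_trans by (metis singletonD)
qed

text \<open>The constant level \<open>n - 1\<close> is a certificate, so the level graph is the
  whole connected graph. For \<open>n = 1\<close> this would fail: the graph is then a single edge,
  which is its own 1-core.\<close>

lemma ikc_nomod_bicliques:
  assumes n: "card A = n" "card B = n" "2 \<le> n"
  shows "ikc_nomod bicliques = {A \<union> B}"
proof -
  have "core_levels bicliques (\<lambda>_. n - 1)"
    unfolding core_levels_def
  proof (intro conjI ballI allI impI)
    fix v assume "v \<in> verts bicliques"
    then have "v \<in> A \<or> v \<in> B" by (simp add: bicliques_def)
    then show "n - 1 \<le> card {u \<in> neighbours bicliques v. n - 1 = n - 1}"
    proof
      assume v: "v \<in> A"
      have "n - 1 = card (A - {v})" using v n fin by simp
      also have "\<dots> \<le> card (neighbours bicliques v)"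
        by (rule card_mono[OF finite_neighbours[OF network_bicliques]])
          (use v in \<open>auto simp: neighbours_bicliques\<close>)
      finally show ?thesis by simp
    next
      assume v: "v \<in> B"
      have "n - 1 = card (B - {v})" using v n fin by simp
      also have "\<dots> \<le> card (neighbours bicliques v)"
        by (rule card_mono[OF finite_neighbours[OF network_bicliques]])
          (use v in \<open>auto simp: neighbours_bicliques\<close>)
      finally show ?thesis by simp
    qed
  next
    fix S k v
    assume S: "S \<subseteq> verts bicliques"
      "\<forall>v\<in>S. n - 1 \<le> k \<and> k \<le> card (S \<inter> neighbours bicliques v)" and v: "v \<in> S"
    show "n - 1 = k"
    proof (rule ccontr)
      assume "n - 1 \<noteq> k"
      then have kn: "n \<le> k" using S v by force
      have big: "n \<le> card (S \<inter> neighbours bicliques w)" if "w \<in> S" for w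
        using S that kn by force
      have card: "card (S \<inter> (A - {w})) \<le> n - 1" if "w \<in> A" for w
        using card_mono[of "A - {w}" "S \<inter> (A - {w})"] that n fin by simp
      have card': "card (S \<inter> (B - {w})) \<le> n - 1" if "w \<in> B" for w
        using card_mono[of "B - {w}" "S \<inter> (B - {w})"] that n fin by simp
      \<comment> \<open>A vertex off the bridge has only the \<open>n - 1\<close> neighbours in its
        own clique, too few for minimum degree \<open>n\<close> in \<open>S\<close>.\<close>
      have Sab: "w \<in> {a, b}" if w: "w \<in> S" for w
      proof (rule ccontr)
        assume "w \<notin> {a, b}"
        moreover have "w \<in> A \<or> w \<in> B" using w S by (auto simp: bicliques_def)
        ultimately have "card (S \<inter> neighbours bicliques w) \<le> n - 1"
          using card[of w] card'[of w] by (auto simp: neighbours_bicliques)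
        then show False using big[OF w] n by simp
      qed
      have "S \<inter> neighbours bicliques v \<subseteq> {a, b} - {v}"
        using Sab neighbours_subset[OF network_bicliques, of v] by blast
      then have "card (S \<inter> neighbours bicliques v) \<le> card ({a, b} - {v})"
        by (intro card_mono) auto
      \<comment> \<open>Inside the bridge alone the degree is at most 1, which is below
        \<open>n\<close> because \<open>2 \<le> n\<close>.\<close>
      also have "\<dots> \<le> 1" using Sab[OF v] by (auto simp: card_insert_if)
      finally show False using big[OF v] n by simp
    qed
  qed
  then have "ikc_nomod bicliques = conn_components (level_graph bicliques (\<lambda>_. n - 1))"
    by (rule ikc_nomod_eq_level_components[OF network_bicliques])
  also have "level_graph bicliques (\<lambda>_. n - 1) = bicliques"
    by (cases bicliques) (simp add: level_graph_def)
  finally show ?thesis by (simp add: conn_components_bicliques)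
qed

lemma pair_of_cliques_bicliques:
  assumes "card A = n" "card B = n"
  shows "pair_of_cliques bicliques A B n"
  unfolding pair_of_cliques_def
proof (intro conjI)
  show "clique bicliques A" "clique bicliques B"
    using bicliques_edge by (auto simp: clique_def) (auto simp: bicliques_def)
  show "\<exists>!e. e \<in> edges bicliques \<and> (\<exists>a\<in>A. \<exists>b\<in>B. e = {a, b})"
  proof (rule ex1I[of _ "{a, b}"])
    show "{a, b} \<in> edges bicliques \<and> (\<exists>a'\<in>A. \<exists>b'\<in>B. {a, b} = {a', b'})"
      using ab by (auto simp: bicliques_def)
    show "e = {a, b}" if e: "e \<in> edges bicliques \<and> (\<exists>a\<in>A. \<exists>b\<in>B. e = {a, b})" for e
    proof -
      obtain x y where xy: "x \<in> A" "y \<in> B" "e = {x, y}" using e by blast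
      then have "y \<in> neighbours bicliques x"
        using e by (auto simp: neighbours_def insert_commute)
      then show ?thesis using xy disj by (auto simp: neighbours_bicliques split: if_splits)
    qed
  qed
qed (use assms disj in \<open>auto simp: conn_components_bicliques\<close>)

text \<open>The bridge alone is a cut: once it is deleted, no edge leaves \<open>A\<close>, so
  \<open>b\<close> cannot be reached from \<open>a\<close>.\<close>

lemma min_edge_cut_bicliques: "min_edge_cut bicliques \<le> 1"
proof -
  let ?H = "(verts bicliques, edges bicliques - {{a, b}})"
  have "(a, b) \<notin> reachable ?H"
  proof
    assume "(a, b) \<in> reachable ?H"
    then have "b \<in> A"
    proof (rule reachable_closed)
      show "y \<in> A" if "x \<in> A" "{x, y} \<in> edges ?H" for x y
        using that disj ab unfolding bicliques_def intra_pairs_def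
        by (auto simp: doubleton_eq_iff)
    qed (rule ab)
    then show False using disj ab by blast
  qed
  then have "\<not> connected_graph ?H" using ab by (auto simp: connected_graph_def bicliques_def)
  moreover have "{a, b} \<in> edges bicliques" by (simp add: bicliques_def)
  moreover have "finite (edges bicliques)" by (rule network_finite_edges[OF network_bicliques])
  ultimately have "min_edge_cut bicliques \<le> card {{a, b}}"
    unfolding min_edge_cut_def by (intro Min_le finite_imageI imageI) auto
  then show ?thesis by simp
qed

section \<open>A clique joined by a bridge to the centre of a star\<close>

definition clique_star :: "'a graph" where
  "clique_star = (A \<union> B, insert {a, b} (intra_pairs {A} \<union> (\<lambda>x. {b, x}) ` (B - {b})))"

lemma network_clique_star: "network clique_star"
proof -
  have "network (A \<union> B, intra_pairs {A})" using fin by (intro network_intra_pairs) auto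
  moreover have "a \<noteq> b" using disj ab by auto
  ultimately show ?thesis using ab by (auto simp: clique_star_def network_def card_2_iff)
qed

lemma neighbours_clique_star:
  "v \<in> A \<Longrightarrow> neighbours clique_star v = (A - {v}) \<union> (if v = a then {b} else {})"
  "neighbours clique_star b = insert a (B - {b})"
  "v \<in> B \<Longrightarrow> v \<noteq> b \<Longrightarrow> neighbours clique_star v = {b}"
  using disj ab unfolding neighbours_def clique_star_def intra_pairs_def
  by (auto simp: doubleton_eq_iff)

text \<open>The triangle has level 2 and the star level 1. Any set meeting the star contains a
  vertex with at most one neighbour in the set, so the bridge cannot lift the star into a
  2-core.\<close>

lemma ikc_nomod_clique_star:
  assumes A: "card A = 3" and B: "2 \<le> card B"
  shows "ikc_nomod clique_star = {A, B}"
proof -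
  define \<kappa> :: "'a \<Rightarrow> nat" where "\<kappa> = (\<lambda>v. if v \<in> A then 2 else 1)"
  have kA: "\<kappa> v = 2" if "v \<in> A" for v using that by (simp add: \<kappa>_def)
  have kB: "\<kappa> v = 1" if "v \<in> B" for v using that disj by (auto simp: \<kappa>_def)
  note finn = finite_neighbours[OF network_clique_star]
  have "core_levels clique_star \<kappa>"
    unfolding core_levels_def
  proof (intro conjI ballI allI impI)
    fix v assume "v \<in> verts clique_star"
    then consider "v \<in> A" | "v = b" | "v \<in> B" "v \<noteq> b" by (auto simp: clique_star_def)
    then show "\<kappa> v \<le> card {u \<in> neighbours clique_star v. \<kappa> u = \<kappa> v}"
    proof cases
      case 1
      have "\<kappa> v = card (A - {v})" using 1 A fin by (simp add: kA)
      also have "\<dots> \<le> card {u \<in> neighbours clique_star v. \<kappa> u = \<kappa> v}"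
        by (rule card_mono) (use finn 1 in \<open>simp, auto simp: neighbours_clique_star kA\<close>)
      finally show ?thesis .
    next
      case 2
      \<comment> \<open>The bridge leads to another level, so the centre needs a leaf for its level;
        \<open>2 \<le> card B\<close> supplies one.\<close>
      have "\<kappa> v \<le> card (B - {b})" using 2 ab B fin by (simp add: kB)
      also have "\<dots> \<le> card {u \<in> neighbours clique_star v. \<kappa> u = \<kappa> v}"
        by (rule card_mono) (use finn 2 ab in \<open>simp, auto simp: neighbours_clique_star kB\<close>)
      finally show ?thesis .
    next
      case 3
      then have "{u \<in> neighbours clique_star v. \<kappa> u = \<kappa> v} = {b}"
        using ab by (auto simp: neighbours_clique_star kB)
      then show ?thesis using 3 by (simp add: kB)
    qed
  next
    fix S k v
    assume S: "S \<subseteq> verts clique_star"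
      "\<forall>v\<in>S. \<kappa> v \<le> k \<and> k \<le> card (S \<inter> neighbours clique_star v)" and v: "v \<in> S"
    have SAB: "w \<in> A \<or> w \<in> B" if "w \<in> S" for w using S that by (auto simp: clique_star_def)
    show "\<kappa> v = k"
    proof (cases "S \<inter> B = {}")
      case True
      then have "v \<in> A" using SAB[OF v] v by blast
      have "S \<inter> neighbours clique_star v \<subseteq> A - {v}"
        using True SAB neighbours_subset[OF network_clique_star, of v] by blast
      then have "card (S \<inter> neighbours clique_star v) \<le> card (A - {v})"
        using fin by (intro card_mono) auto
      also have "\<dots> = 2" using \<open>v \<in> A\<close> A fin by simp
      finally show ?thesis using S v kA[OF \<open>v \<in> A\<close>] by force
    next
      case False
      \<comment> \<open>Such a vertex is a leaf if \<open>S\<close> contains one, with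
        \<open>b\<close> as its only neighbour; otherwise it is \<open>b\<close> itself, whose only
        neighbour outside the leaves is \<open>a\<close>.\<close>
      have "\<exists>w\<in>S. \<exists>x. S \<inter> neighbours clique_star w \<subseteq> {x}"
      proof (cases "S \<inter> B \<subseteq> {b}")
        case True
        then have "b \<in> S" "S \<inter> neighbours clique_star b \<subseteq> {a}"
          using False by (auto simp: neighbours_clique_star)
        then show ?thesis by blast
      next
        case False
        then obtain w where "w \<in> S" "w \<in> B" "w \<noteq> b" by blast
        then have "w \<in> S" "S \<inter> neighbours clique_star w \<subseteq> {b}"
          by (auto simp: neighbours_clique_star)
        then show ?thesis by blast
      qed
      then obtain w x where w: "w \<in> S" "S \<inter> neighbours clique_star w \<subseteq> {x}" by blast
      have "k \<le> card (S \<inter> neighbours clique_star w)" using S w(1) by blast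
      also have "\<dots> \<le> card {x}" using w(2) by (intro card_mono) auto
      finally have "k \<le> 1" by simp
      moreover have "\<kappa> v \<le> k" "1 \<le> \<kappa> v" using S v by (auto simp: \<kappa>_def)
      ultimately show ?thesis by simp
    qed
  qed
  then have "ikc_nomod clique_star = conn_components (level_graph clique_star \<kappa>)"
    by (rule ikc_nomod_eq_level_components[OF network_clique_star])
  also have "\<dots> = {A, B}"
  proof (rule conn_components_eqI)
    show "partition_on (verts (level_graph clique_star \<kappa>)) {A, B}"
      using ab disj by (auto simp: partition_on_def clique_star_def disjoint_def)
  next
    let ?L = "level_graph clique_star \<kappa>"
    fix c x y assume c: "c \<in> {A, B}" "x \<in> c" "{x, y} \<in> edges ?L"
    \<comment> \<open>The bridge joins levels 2 and 1 and hence is missing from the level graph; the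
      level of a vertex tells its side.\<close>
    have "\<kappa> x = \<kappa> y" "y \<in> A \<or> y \<in> B"
      using level_graph_edge[OF network_clique_star c(3)] by (auto simp: clique_star_def)
    then show "y \<in> c" using c kA kB by fastforce
  next
    let ?L = "level_graph clique_star \<kappa>"
    fix c x y assume c: "c \<in> {A, B}" "x \<in> c" "y \<in> c"
    have "(b, z) \<in> reachable ?L" if "z \<in> B" for z
    proof (cases "z = b")
      case False
      then have "{b, z} \<in> edges ?L"
        using that ab kB by (intro level_graph_edgeI) (auto simp: clique_star_def)
      then show ?thesis by (rule reachable_edge)
    qed (simp add: reachable_refl)
    then have inB: "(x, y) \<in> reachable ?L" if "c = B"
      using that c reachable_sym reachable_trans by metis
    have inA: "(x, y) \<in> reachable ?L" if "c = A"
    proof (cases "x = y")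
      case False
      then have "{x, y} \<in> edges ?L"
        using that c kA by (intro level_graph_edgeI) (auto simp: clique_star_def intra_pairs_def)
      then show ?thesis by (rule reachable_edge)
    qed (simp add: reachable_refl)
    show "(x, y) \<in> reachable ?L" using c(1) inA inB by blast
  qed
  finally show ?thesis .
qed

text \<open>Nothing is deleted. The added pairs include the star edges already present, which the
  union absorbs.\<close>

lemma consistent_change_clique_star:
  "consistent_change {A, B} (edges clique_star) (edges bicliques)"
  unfolding consistent_change_def
proof (rule exI[of _ "{}"], rule exI[of _ "intra_pairs {B}"], intro conjI)
  show "edges bicliques = edges clique_star - {} \<union> intra_pairs {B}"
    using ab unfolding bicliques_def clique_star_def intra_pairs_def by auto
qed (auto simp: intra_pairs_def)

end

section \<open>Refutation of the four failing axioms\<close>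

text \<open>An infinite vertex type has room for disjoint sets of any finite size. Arbitrarily large
  cliques are wanted, as Connectivity and Pair-of-Cliques constrain the method only
  asymptotically.\<close>

lemma joined_sets_exist:
  assumes "infinite (UNIV :: 'a set)" "0 < n"
  obtains A B :: "'a set" and a b where "joined_sets A B a b" "card A = n" "card B = n"
proof -
  obtain A :: "'a set" where A: "finite A" "card A = n"
    using infinite_arbitrarily_large[OF assms(1)] by blast
  then have "infinite (UNIV - A)" using assms(1) by simp
  then obtain B where B: "finite B" "card B = n" "B \<subseteq> UNIV - A"
    using infinite_arbitrarily_large by blast
  obtain a b where "a \<in> A" "b \<in> B" using A B assms(2) by fastforce
  then show ?thesis using A B by (intro that[of A B a b]) (auto simp: joined_sets_def)
qed

lemma ikc_nomod_not_refinement_consistency: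
  assumes "infinite (UNIV :: 'a set)"
  shows "\<not> refinement_consistency (ikc_nomod :: 'a clustering_method)"
proof
  assume ref: "refinement_consistency (ikc_nomod :: 'a clustering_method)"
  obtain A B :: "'a set" and a b where J: "joined_sets A B a b" "card A = 3" "card B = 3"
    by (rule joined_sets_exist[OF assms, of 3]) simp
  interpret joined_sets A B a b by (rule J(1))
  let ?E = "edges clique_star" and ?E' = "edges bicliques"
  have eq: "(A \<union> B, ?E) = clique_star" "(A \<union> B, ?E') = bicliques"
    by (auto simp: clique_star_def bicliques_def)
  have ikc: "ikc_nomod clique_star = {A, B}" "ikc_nomod bicliques = {A \<union> B}"
    using J by (simp_all add: ikc_nomod_clique_star ikc_nomod_bicliques[of 3])
  have "\<forall>c'\<in>ikc_nomod (A \<union> B, ?E'). \<exists>c\<in>ikc_nomod (A \<union> B, ?E). c' \<subseteq> c"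
    using ref[unfolded refinement_consistency_def, rule_format, of "A \<union> B" ?E ?E']
      network_clique_star network_bicliques consistent_change_clique_star
    unfolding eq ikc by blast
  \<comment> \<open>The merged cluster contains both \<open>a\<close> and \<open>b\<close>, so it
    fits into neither \<open>A\<close> nor \<open>B\<close>.\<close>
  then show False using ab disj unfolding eq ikc by auto
qed

text \<open>Equal clusterings refine each other, so the one counterexample to refinement refutes
  both consistency axioms.\<close>

lemma standard_imp_refinement_consistency:
  "standard_consistency M \<Longrightarrow> refinement_consistency M"
  unfolding standard_consistency_def refinement_consistency_def by blast

lemma ikc_nomod_not_connectivity:
  assumes "infinite (UNIV :: 'a set)"
  shows "\<not> connectivity_axiom (ikc_nomod :: 'a clustering_method)"
proof
  assume "connectivity_axiom (ikc_nomod :: 'a clustering_method)"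
  then obtain f :: "real \<Rightarrow> real" where lim: "filterlim f at_top at_top"
    and cut: "\<And>(N :: 'a graph) c. network N \<Longrightarrow> c \<in> ikc_nomod N \<Longrightarrow> 2 \<le> card c \<Longrightarrow>
        f (real (card c)) < real (min_edge_cut (induced N c))"
    unfolding connectivity_axiom_def by blast
  obtain x0 where x0: "\<And>x. x0 \<le> x \<Longrightarrow> 1 \<le> f x"
    using lim unfolding filterlim_at_top eventually_at_top_linorder by blast
  \<comment> \<open>The cluster has \<open>2 * n\<close> vertices; this size reaches
    \<open>x0\<close>, so \<open>f\<close> is at least 1 there, although it would have to lie
    strictly below a cut of size at most 1.\<close>
  define n where "n = max 2 (nat \<lceil>x0\<rceil>)"
  have n: "2 \<le> n" "x0 \<le> real (2 * n)" unfolding n_def by linarith+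
  obtain A B :: "'a set" and a b where J: "joined_sets A B a b" "card A = n" "card B = n"
    by (rule joined_sets_exist[OF assms, of n]) (use n in simp)
  interpret joined_sets A B a b by (rule J(1))
  have card: "card (A \<union> B) = 2 * n" using J fin disj by (simp add: card_Un_disjoint)
  have "induced bicliques (A \<union> B) = bicliques"
    using induced_verts[OF network_bicliques] by (simp add: bicliques_def)
  then have "f (real (2 * n)) < real (min_edge_cut bicliques)"
    using cut[OF network_bicliques, of "A \<union> B"] ikc_nomod_bicliques[OF J(2,3) n(1)] card n by simp
  also have "\<dots> \<le> 1" using min_edge_cut_bicliques by simp
  finally show False using x0[OF n(2)] by simp
qed

lemma ikc_nomod_not_pair_of_cliques:
  assumes "infinite (UNIV :: 'a set)"
  shows "\<not> pair_of_cliques_axiom (ikc_nomod :: 'a clustering_method)"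
proof
  assume "pair_of_cliques_axiom (ikc_nomod :: 'a clustering_method)"
  then obtain n0 where n0: "\<And>(N :: 'a graph) A B n. network N \<Longrightarrow> pair_of_cliques N A B n \<Longrightarrow>
      n0 \<le> 2 * n \<Longrightarrow> A \<in> ikc_nomod N"
    unfolding pair_of_cliques_axiom_def by blast
  \<comment> \<open>Large enough for the threshold \<open>n0\<close> and for the merging of the two
    cliques, which needs \<open>2 \<le> n\<close>.\<close>
  define n where "n = max 2 n0"
  have n: "2 \<le> n" "n0 \<le> 2 * n" by (auto simp: n_def)
  obtain A B :: "'a set" and a b where J: "joined_sets A B a b" "card A = n" "card B = n"
    by (rule joined_sets_exist[OF assms, of n]) (use n in simp)
  interpret joined_sets A B a b by (rule J(1))
  have "A \<in> ikc_nomod bicliques"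
    using n0[OF network_bicliques pair_of_cliques_bicliques[OF J(2,3)] n(2)] .
  then show False using ikc_nomod_bicliques[OF J(2,3) n(1)] ab disj by auto
qed

theorem theorem6:
  assumes "infinite (UNIV :: 'a set)"
  shows "richness (ikc_nomod :: 'a clustering_method)
    \<and> inter_edge_consistency (ikc_nomod :: 'a clustering_method)
    \<and> fixed_point (ikc_nomod :: 'a clustering_method)
    \<and> \<not> standard_consistency (ikc_nomod :: 'a clustering_method)
    \<and> \<not> refinement_consistency (ikc_nomod :: 'a clustering_method)
    \<and> \<not> connectivity_axiom (ikc_nomod :: 'a clustering_method)
    \<and> \<not> pair_of_cliques_axiom (ikc_nomod :: 'a clustering_method)"
  using ikc_nomod_richness ikc_nomod_inter_edge_consistency ikc_nomod_fixed_point
    ikc_nomod_not_refinement_consistency[OF assms] standard_imp_refinement_consistency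
    ikc_nomod_not_connectivity[OF assms] ikc_nomod_not_pair_of_cliques[OF assms]
  by blast

end
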